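(* If $(X,d)$ is a compact metric space without isolated points and $T\colon X\to X$ is a transitive continuous map which satisfies the shadowing property, then $\{x\in X\colon V_T(x)=\mathcal{P}_T(X)\}$ is Baire generic in $X$.
   Context: $\mathbb{N}=\{1,2,\dots\}$. $T$ is transitive if for all nonempty open $U,V\subset X$ there is $n\in\mathbb{N}$ with $U\cap T^{-n}(V)\ne\emptyset$. A sequence $\{x_n\}_{n\in\mathbb{N}}\subset X$ is a $\delta$-pseudo-orbit if $d(T(x_n),x_{n+1})<\delta$ for all $n\in\mathbb{N}$; it is $\varepsilon$-shadowed if there is $y\in X$ with $d(T^n(y),x_n)<\varepsilon$ for all $n\in\mathbb{N}$. $T$ has the shadowing property if for every $\varepsilon>0$ there is $\delta>0$ such that every $\delta$-pseudo-orbit is $\varepsilon$-shadowed. $\mathcal{P}_T(X)$ is the space of $T$-invariant Borel probability measures on $X$ with the weak$^*$ topology, and $V_T(x)$ is the set of weak$^*$ accumulation points (limits of subsequences) of the empirical measures $\frac1n\sum_{j=0}^{n-1}\delta_{T^j(x)}$, $n\ge1$. A set is Baire generic in $X$ if it contains a countable intersection of open dense subsets of $X$. *)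

theory Defs
  imports "HOL-Probability.Probability"
begin

definition topologically_transitive :: "('a::topological_space \<Rightarrow> 'a) \<Rightarrow> bool" where
  "topologically_transitive T \<longleftrightarrow>
     (\<forall>U V. open U \<and> U \<noteq> {} \<and> open V \<and> V \<noteq> {} \<longrightarrow>
        (\<exists>n\<ge>1. U \<inter> (T ^^ n) -` V \<noteq> {}))"

(* Sequences are indexed by {1, 2, ...}; the value x 0 is irrelevant. *)

definition pseudo_orbit :: "('a::metric_space \<Rightarrow> 'a) \<Rightarrow> real \<Rightarrow> (nat \<Rightarrow> 'a) \<Rightarrow> bool" where
  "pseudo_orbit T \<delta> x \<longleftrightarrow> (\<forall>n\<ge>1. dist (T (x n)) (x (Suc n)) < \<delta>)"

definition shadowed :: "('a::metric_space \<Rightarrow> 'a) \<Rightarrow> real \<Rightarrow> (nat \<Rightarrow> 'a) \<Rightarrow> bool" where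
  "shadowed T \<epsilon> x \<longleftrightarrow> (\<exists>y. \<forall>n\<ge>1. dist ((T ^^ n) y) (x n) < \<epsilon>)"

definition shadowing_property :: "('a::metric_space \<Rightarrow> 'a) \<Rightarrow> bool" where
  "shadowing_property T \<longleftrightarrow>
     (\<forall>\<epsilon>>0. \<exists>\<delta>>0. \<forall>x. pseudo_orbit T \<delta> x \<longrightarrow> shadowed T \<epsilon> x)"

definition borel_prob_measures :: "'a::topological_space measure set" where
  "borel_prob_measures = {\<mu>. prob_space \<mu> \<and> sets \<mu> = sets borel}"

definition invariant_measures :: "('a::topological_space \<Rightarrow> 'a) \<Rightarrow> 'a measure set" where
  "invariant_measures T =
     {\<mu> \<in> borel_prob_measures. \<forall>A\<in>sets borel. emeasure \<mu> (T -` A) = emeasure \<mu> A}"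

(* The coarsest topology on the Borel probability measures for which integration against every
   continuous real function is continuous. All continuous functions are admitted as test functions,
   so this is the weak* topology only for compact spaces, where they are bounded. *)
definition weak_star_topology :: "'a::topological_space measure topology" where
  "weak_star_topology =
     pullback_topology borel_prob_measures
       (\<lambda>\<mu>. \<lambda>f\<in>{f. continuous_on UNIV f}. integral\<^sup>L \<mu> f)
       (product_topology (\<lambda>_. euclideanreal) {f. continuous_on UNIV f})"

lemma topspace_weak_star: "topspace weak_star_topology = borel_prob_measures"
  by (auto simp: weak_star_topology_def topspace_pullback_topology)

lemma limitin_weak_star_iff:
  fixes \<mu> :: "'a::topological_space measure"
  assumes "\<And>n. M n \<in> borel_prob_measures"
  shows "limitin weak_star_topology M \<mu> F \<longleftrightarrow>
    \<mu> \<in> borel_prob_measures \<and>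
    (\<forall>f::'a \<Rightarrow> real. continuous_on UNIV f \<longrightarrow>
       ((\<lambda>n. integral\<^sup>L (M n) f) \<longlongrightarrow> integral\<^sup>L \<mu> f) F)"
proof -
  let ?C = "{f::'a \<Rightarrow> real. continuous_on UNIV f}"
  let ?P = "product_topology (\<lambda>_. euclideanreal) ?C"
  let ?I = "\<lambda>\<mu>. \<lambda>f\<in>?C. integral\<^sup>L \<mu> f"
  have "limitin weak_star_topology M \<mu> F \<longleftrightarrow>
      \<mu> \<in> borel_prob_measures \<and> limitin ?P (\<lambda>n. ?I (M n)) (?I \<mu>) F"
  proof (cases "\<mu> \<in> borel_prob_measures")
    case True
    show ?thesis
    proof
      assume L: "limitin weak_star_topology M \<mu> F"
      have "continuous_map weak_star_topology ?P ?I"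
        unfolding weak_star_topology_def
        using continuous_map_pullback[OF continuous_map_id, of borel_prob_measures ?I ?P]
        by (simp add: id_def o_def)
      from continuous_map_limit[OF this L] True
      show "\<mu> \<in> borel_prob_measures \<and> limitin ?P (\<lambda>n. ?I (M n)) (?I \<mu>) F"
        by (simp add: o_def)
    next
      assume R: "\<mu> \<in> borel_prob_measures \<and> limitin ?P (\<lambda>n. ?I (M n)) (?I \<mu>) F"
      show "limitin weak_star_topology M \<mu> F"
        unfolding limitin_def topspace_weak_star
      proof (intro conjI allI impI)
        show "\<mu> \<in> borel_prob_measures" using True .
        fix U assume U: "openin weak_star_topology U \<and> \<mu> \<in> U"
        then obtain W where W: "openin ?P W" "U = ?I -` W \<inter> borel_prob_measures"
          by (auto simp: weak_star_topology_def openin_pullback_topology)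
        then have "eventually (\<lambda>n. ?I (M n) \<in> W) F"
          using R U unfolding limitin_def by blast
        then show "eventually (\<lambda>n. M n \<in> U) F"
          using W assms by auto
      qed
    qed
  next
    case False
    then show ?thesis
      using limitin_topspace[of weak_star_topology M \<mu> F] by (auto simp: topspace_weak_star)
  qed
  then show ?thesis
    by (auto simp: limitin_componentwise extensional_def)
qed

definition empirical_measure ::
    "('a::topological_space \<Rightarrow> 'a) \<Rightarrow> 'a \<Rightarrow> nat \<Rightarrow> 'a measure" where
  "empirical_measure T x n =
     measure_of UNIV (sets borel)
       (\<lambda>A. ennreal (1 / real n) * (\<Sum>j<n. emeasure (return borel ((T ^^ j) x)) A))"

lemma sets_empirical_measure [simp]: "sets (empirical_measure T x n) = sets borel"
  unfolding empirical_measure_def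
  by (subst sets_measure_of) (auto simp: sets.sigma_sets_eq[of borel, simplified])

lemma emeasure_empirical_measure:
  assumes "A \<in> sets borel"
  shows "emeasure (empirical_measure T x n) A =
    ennreal (1 / real n) * (\<Sum>j<n. emeasure (return borel ((T ^^ j) x)) A)"
proof (rule emeasure_measure_of[OF empirical_measure_def])
  show "sets borel \<subseteq> Pow UNIV" by simp
  show "A \<in> sets (empirical_measure T x n)" using assms by simp
  show "positive (sets (empirical_measure T x n))
     (\<lambda>A. ennreal (1 / real n) * (\<Sum>j<n. emeasure (return borel ((T ^^ j) x)) A))"
    by (simp add: positive_def)
  show "countably_additive (sets (empirical_measure T x n))
     (\<lambda>A. ennreal (1 / real n) * (\<Sum>j<n. emeasure (return borel ((T ^^ j) x)) A))"
    unfolding countably_additive_def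
  proof (intro allI impI)
    fix B :: "nat \<Rightarrow> 'a set"
    assume B: "range B \<subseteq> sets (empirical_measure T x n)" "disjoint_family B"
    have "(\<Sum>i. \<Sum>j<n. emeasure (return borel ((T ^^ j) x)) (B i)) =
        (\<Sum>j<n. \<Sum>i. emeasure (return borel ((T ^^ j) x)) (B i))"
      by (rule suminf_sum) simp
    also have "\<dots> = (\<Sum>j<n. emeasure (return borel ((T ^^ j) x)) (\<Union>i. B i))"
      using B by (intro sum.cong refl suminf_emeasure) auto
    finally show "(\<Sum>i. ennreal (1 / real n) *
          (\<Sum>j<n. emeasure (return borel ((T ^^ j) x)) (B i))) =
        ennreal (1 / real n) * (\<Sum>j<n. emeasure (return borel ((T ^^ j) x)) (\<Union>i. B i))"
      by simp
  qed
qed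

definition limit_measures :: "('a::topological_space \<Rightarrow> 'a) \<Rightarrow> 'a \<Rightarrow> 'a measure set" where
  "limit_measures T x =
     {\<mu>. \<exists>r::nat \<Rightarrow> nat. strict_mono r \<and> (\<forall>k. r k \<ge> 1) \<and>
        limitin weak_star_topology (\<lambda>k. empirical_measure T x (r k)) \<mu> sequentially}"

definition baire_generic :: "'a::topological_space set \<Rightarrow> bool" where
  "baire_generic S \<longleftrightarrow>
     (\<exists>\<G>. countable \<G> \<and> (\<forall>U\<in>\<G>. open U \<and> closure U = UNIV) \<and> \<Inter>\<G> \<subseteq> S)"

end

theory Submission
  imports Defs
begin

text \<open>
  Every accumulation point of empirical measures is invariant, because the Birkhoff averages of
  \<open>f\<close> and \<open>f \<circ> T\<close> over \<open>n\<close> steps differ by a boundary term of order \<open>1 / n\<close>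
  (\<open>limit_measures_invariant\<close>). For the converse inclusion, the space of continuous functions is
  separable, so a measure is tested by countably many functions \<open>g k\<close> taken from partitions of
  unity. The points whose averages of \<open>g 0, \<dots>, g (K - 1)\<close> come close, at some time beyond \<open>N\<close>,
  to a given rational vector form an open set; there are countably many such sets, and a
  point that lies in all those that are dense realises every invariant measure, provided that
  each invariant measure yields dense sets. That density is \<open>dense_prescribed_averages\<close>.

  The density argument rests on an exact identity for integrals: if \<open>\<mu>\<close> is invariant,
  then the average \<open>A\<^sub>n f\<close> over \<open>n\<close> steps has the same integral as \<open>f\<close>, for every \<open>n\<close>. Approximating \<open>\<mu>\<close> by an equidistribution on a finite list of points, tested on the functions
  \<open>A\<^sub>n f\<close> (\<open>finite_point_approx\<close>), gives points \<open>y\<^sub>1, \<dots>, y\<^sub>m\<close> for which the mean of the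
  \<open>A\<^sub>n f y\<^sub>i\<close> is close to the integral of \<open>f\<close>. By transitivity and compactness any two points are
  linked by a pseudo-orbit of length at most \<open>L\<close>, where \<open>L\<close> depends only on the allowed jump
  (\<open>bounded_links\<close>). Hence a pseudo-orbit can start in a prescribed open set and run through the
  \<open>m\<close> orbit segments of length \<open>n\<close> with links in between
  (\<open>pseudo_orbit_through_segments\<close>), and as \<open>n\<close> is chosen after \<open>L\<close>, the links take up a negligible
  share of the time. A shadowing point has almost the same averages.
\<close>

section \<open>Continuous functions on a compact space\<close>

lemma uniform_modulus:
  fixes F :: "('a::metric_space \<Rightarrow> real) set"
  assumes "compact (UNIV :: 'a set)" "finite F" "\<And>f. f \<in> F \<Longrightarrow> continuous_on UNIV f" "\<epsilon> > 0"
  shows "\<exists>\<delta>>0. \<forall>f\<in>F. \<forall>x y. dist x y < \<delta> \<longrightarrow> \<bar>f x - f y\<bar> < \<epsilon>"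
  using assms(2,3)
proof (induction F)
  case empty
  show ?case by (auto intro: exI[of _ 1])
next
  case (insert f F)
  obtain d1 where d1: "d1 > 0" "\<forall>f\<in>F. \<forall>x y. dist x y < d1 \<longrightarrow> \<bar>f x - f y\<bar> < \<epsilon>"
    using insert by auto
  have "uniformly_continuous_on UNIV f"
    using insert assms(1) by (intro compact_uniformly_continuous) auto
  then obtain d2 where d2: "d2 > 0" "\<forall>x y. dist x y < d2 \<longrightarrow> \<bar>f y - f x\<bar> < \<epsilon>"
    using assms(4) by (auto simp: uniformly_continuous_on_def dist_real_def dist_commute)
  show ?case
    using d1 d2 by (intro exI[of _ "min d1 d2"]) (auto simp: abs_minus_commute)
qed

lemma finite_ball_cover:
  assumes "compact (UNIV :: 'a::metric_space set)" "r > 0"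
  shows "\<exists>S :: 'a set. finite S \<and> UNIV \<subseteq> (\<Union>x\<in>S. ball x r)"
proof -
  have "UNIV \<subseteq> (\<Union>x\<in>UNIV::'a set. ball x r)"
    using assms(2) centre_in_ball by blast
  from compactE_image[OF assms(1) _ this] show ?thesis by (metis open_ball)
qed

text \<open>The functions are normalised cone functions on the balls of a finite cover.
  Continuity and bounds hold for all indices (beyond \<open>p\<close> the functions are set to zero), so that
  families of different sizes can later be merged into one sequence.\<close>

lemma partition_of_unity:
  fixes \<delta> :: real
  assumes "compact (UNIV :: 'a::metric_space set)" "\<delta> > 0"
  shows "\<exists>p (s :: nat \<Rightarrow> 'a) (\<phi> :: nat \<Rightarrow> 'a \<Rightarrow> real).
    (\<forall>i. continuous_on UNIV (\<phi> i)) \<and> (\<forall>i x. 0 \<le> \<phi> i x \<and> \<phi> i x \<le> 1) \<and>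
    (\<forall>x. (\<Sum>i<p. \<phi> i x) = 1) \<and> (\<forall>i<p. \<forall>x. \<phi> i x \<noteq> 0 \<longrightarrow> dist x (s i) < \<delta>)"
proof -
  obtain S :: "'a set" where S: "finite S" "UNIV \<subseteq> (\<Union>x\<in>S. ball x \<delta>)"
    using finite_ball_cover[OF assms(1), of "\<delta>"] assms(2) by auto
  obtain s p where s: "S = s ` {i::nat. i < p}"
    using finite_imp_nat_seg_image_inj_on[OF S(1)] by blast
  define \<psi> where "\<psi> i x = max 0 (\<delta> - dist x (s i))" for i x
  define \<sigma> where "\<sigma> x = (\<Sum>i<p. \<psi> i x)" for x
  define \<phi> where "\<phi> i x = (if i < p then \<psi> i x / \<sigma> x else 0)" for i x
  have nn: "0 \<le> \<psi> i x" for i x by (simp add: \<psi>_def)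
  have pos: "\<sigma> x > 0" for x
  proof -
    obtain i where i: "i < p" "dist x (s i) < \<delta>"
      using S(2) s by (auto simp: subset_eq dist_commute)
    have "0 < \<psi> i x" using i by (simp add: \<psi>_def)
    also have "\<dots> \<le> \<sigma> x" unfolding \<sigma>_def
      by (rule member_le_sum) (use i nn in auto)
    finally show ?thesis .
  qed
  have le: "\<psi> i x \<le> \<sigma> x" if "i < p" for i x
    unfolding \<sigma>_def by (rule member_le_sum) (use that nn in auto)
  have c: "continuous_on UNIV (\<psi> i)" for i
    unfolding \<psi>_def by (intro continuous_intros)
  have c\<sigma>: "continuous_on UNIV \<sigma>"
    unfolding \<sigma>_def using c by (intro continuous_intros)
  have "continuous_on UNIV (\<phi> i)" for i
  proof (cases "i < p")
    case True
    then show ?thesis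
      using c c\<sigma> pos unfolding \<phi>_def by (simp, intro continuous_intros) (auto simp: less_imp_neq[THEN not_sym])
  qed (simp add: \<phi>_def)
  moreover have "0 \<le> \<phi> i x \<and> \<phi> i x \<le> 1" for i x
    using nn[of i x] pos[of x] le[of i x] by (auto simp: \<phi>_def)
  moreover have "(\<Sum>i<p. \<phi> i x) = 1" for x
  proof -
    have "(\<Sum>i<p. \<phi> i x) = \<sigma> x / \<sigma> x"
      unfolding \<sigma>_def[of x] sum_divide_distrib by (simp add: \<phi>_def \<sigma>_def)
    then show ?thesis using pos[of x] by simp
  qed
  moreover have "dist x (s i) < \<delta>" if "i < p" "\<phi> i x \<noteq> 0" for i x
    using that by (auto simp: \<phi>_def \<psi>_def max_def split: if_splits)
  ultimately show ?thesis by blast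
qed

lemma partition_of_unity_approx:
  fixes f :: "'a::metric_space \<Rightarrow> real"
  assumes "\<And>i x. 0 \<le> \<phi> i x" "(\<Sum>i<p. \<phi> i x) = 1"
    and "\<And>i. i < p \<Longrightarrow> \<phi> i x \<noteq> 0 \<Longrightarrow> dist x (s i) < \<delta>"
    and "\<And>x y. dist x y < \<delta> \<Longrightarrow> \<bar>f x - f y\<bar> < \<epsilon>" "\<epsilon> > 0"
  shows "\<bar>f x - (\<Sum>i<p. f (s i) * \<phi> i x)\<bar> \<le> \<epsilon>"
proof -
  have "f x - (\<Sum>i<p. f (s i) * \<phi> i x) = (\<Sum>i<p. (f x - f (s i)) * \<phi> i x)"
    using assms(2) by (simp add: left_diff_distrib sum_subtractf flip: sum_distrib_left)
  also have "\<bar>\<dots>\<bar> \<le> (\<Sum>i<p. \<epsilon> * \<phi> i x)"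
  proof (rule sum_abs[THEN order_trans], rule sum_mono)
    fix i assume "i \<in> {..<p}"
    then show "\<bar>(f x - f (s i)) * \<phi> i x\<bar> \<le> \<epsilon> * \<phi> i x"
      using assms(1)[of i x] assms(3)[of i] assms(4)[of x "s i"]
      by (cases "\<phi> i x = 0") (auto simp: abs_mult intro!: mult_right_mono)
  qed
  also have "\<dots> = \<epsilon>" using assms(2) by (simp flip: sum_distrib_left)
  finally show ?thesis .
qed

text \<open>Separability of the space of continuous functions: partitions of unity of mesh \<open>1 / (m + 1)\<close>,
  for all \<open>m\<close>, form a countable family, and a continuous \<open>f\<close> is uniformly close to the
  interpolation of its values by a partition that is finer than the modulus of continuity of \<open>f\<close>.\<close>

lemma countable_total_family:
  assumes "compact (UNIV :: 'a::metric_space set)"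
  obtains g :: "nat \<Rightarrow> 'a::metric_space \<Rightarrow> real" where
    "\<And>k. continuous_on UNIV (g k)" "\<And>k x. \<bar>g k x\<bar> \<le> 1"
    "\<And>f \<epsilon>. continuous_on UNIV f \<Longrightarrow> \<epsilon> > 0 \<Longrightarrow>
      \<exists>p \<sigma> c. \<forall>x. \<bar>f x - (\<Sum>i<(p::nat). c i * g (\<sigma> i) x)\<bar> \<le> \<epsilon>"
proof -
  have "\<forall>m. \<exists>p (s :: nat \<Rightarrow> 'a) (\<phi> :: nat \<Rightarrow> 'a \<Rightarrow> real).
    (\<forall>i. continuous_on UNIV (\<phi> i)) \<and> (\<forall>i x. 0 \<le> \<phi> i x \<and> \<phi> i x \<le> 1) \<and>
    (\<forall>x. (\<Sum>i<p. \<phi> i x) = 1) \<and> (\<forall>i<p. \<forall>x. \<phi> i x \<noteq> 0 \<longrightarrow> dist x (s i) < 1 / real (Suc m))"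
    by (intro allI partition_of_unity[OF assms]) simp
  then obtain p and s :: "nat \<Rightarrow> nat \<Rightarrow> 'a" and \<phi> where
    c: "\<And>m i. continuous_on UNIV (\<phi> m i :: 'a \<Rightarrow> real)" and
    b: "\<And>m i x. 0 \<le> \<phi> m i x \<and> \<phi> m i x \<le> 1" and
    one: "\<And>m x. (\<Sum>i<p m. \<phi> m i x) = 1" and
    near: "\<And>m i x. i < p m \<Longrightarrow> \<phi> m i x \<noteq> 0 \<Longrightarrow> dist x (s m i) < 1 / real (Suc m)"
    by metis
  define g where "g k = (case prod_decode k of (m, i) \<Rightarrow> \<phi> m i)" for k
  have g: "g (prod_encode (m, i)) = \<phi> m i" for m i by (simp add: g_def)
  have "\<exists>q \<sigma> d. \<forall>x. \<bar>f x - (\<Sum>i<(q::nat). d i * g (\<sigma> i) x)\<bar> \<le> \<epsilon>"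
    if f: "continuous_on UNIV f" and e: "\<epsilon> > 0" for f :: "'a \<Rightarrow> real" and \<epsilon> :: real
  proof -
    obtain \<delta> where \<delta>: "\<delta> > 0" "\<forall>x y. dist x y < \<delta> \<longrightarrow> \<bar>f x - f y\<bar> < \<epsilon>"
      using uniform_modulus[OF assms, of "{f}" \<epsilon>] f e by auto
    obtain m where m: "1 / real (Suc m) < \<delta>"
      using reals_Archimedean[OF \<delta>(1)] by (auto simp: inverse_eq_divide)
    have "\<bar>f x - (\<Sum>i<p m. f (s m i) * \<phi> m i x)\<bar> \<le> \<epsilon>" for x
    proof (rule partition_of_unity_approx)
      show "dist x (s m i) < \<delta>" if "i < p m" "\<phi> m i x \<noteq> 0" for i
        using near[OF that] m by (rule less_trans)
    qed (use b one \<delta>(2) e in auto)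
    then show ?thesis
      by (intro exI[of _ "p m"] exI[of _ "\<lambda>i. prod_encode (m, i)"] exI[of _ "\<lambda>i. f (s m i)"])
         (simp add: g)
  qed
  moreover have "continuous_on UNIV (g k)" "\<bar>g k x\<bar> \<le> 1" for k x
    using c b by (auto simp: g_def split: prod.split)
  ultimately show ?thesis using that[of g] by simp
qed

section \<open>Borel probability measures and integrals of continuous functions\<close>

lemma borel_prob_measuresD:
  assumes "\<mu> \<in> borel_prob_measures"
  shows "prob_space \<mu>" "sets \<mu> = sets borel" "space \<mu> = UNIV"
  using assms sets_eq_imp_space_eq[of \<mu> borel] by (auto simp: borel_prob_measures_def)

lemma measurable_continuous:
  fixes f :: "'a::metric_space \<Rightarrow> 'b::topological_space"
  assumes "sets \<mu> = sets borel" "continuous_on UNIV f"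
  shows "f \<in> borel_measurable \<mu>"
  using borel_measurable_continuous_onI[OF assms(2)] measurable_cong_sets[OF assms(1) refl] by blast

lemma compact_bound:
  fixes f :: "'a::metric_space \<Rightarrow> real"
  assumes "compact (UNIV :: 'a set)" "continuous_on UNIV f"
  shows "\<exists>B>0. \<forall>x. \<bar>f x\<bar> \<le> B"
proof -
  have "bounded (range f)"
    using compact_continuous_image[OF assms(2,1)] compact_imp_bounded by blast
  then show ?thesis by (auto simp: bounded_pos)
qed

lemma integrable_continuous:
  fixes f :: "'a::metric_space \<Rightarrow> real"
  assumes "compact (UNIV :: 'a set)" "\<mu> \<in> borel_prob_measures" "continuous_on UNIV f"
  shows "integrable \<mu> f"
proof -
  interpret prob_space \<mu> using borel_prob_measuresD[OF assms(2)] by simp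
  obtain B where "\<forall>x. \<bar>f x\<bar> \<le> B" using compact_bound[OF assms(1,3)] by auto
  then show ?thesis
    using measurable_continuous[OF _ assms(3), of \<mu>] borel_prob_measuresD[OF assms(2)]
    by (intro integrable_const_bound[of _ B]) auto
qed

lemma integral_diff_bound:
  fixes f g :: "'a::metric_space \<Rightarrow> real"
  assumes "compact (UNIV :: 'a set)" "\<mu> \<in> borel_prob_measures"
    "continuous_on UNIV f" "continuous_on UNIV g" "\<And>x. \<bar>f x - g x\<bar> \<le> e"
  shows "\<bar>integral\<^sup>L \<mu> f - integral\<^sup>L \<mu> g\<bar> \<le> e"
proof -
  interpret prob_space \<mu> using borel_prob_measuresD[OF assms(2)] by simp
  have i: "integrable \<mu> f" "integrable \<mu> g"
    using assms by (auto intro!: integrable_continuous)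
  have "\<bar>integral\<^sup>L \<mu> f - integral\<^sup>L \<mu> g\<bar> = \<bar>\<integral>x. f x - g x \<partial>\<mu>\<bar>" using i by simp
  also have "\<dots> \<le> (\<integral>x. \<bar>f x - g x\<bar> \<partial>\<mu>)" by (rule integral_abs_bound)
  also have "\<dots> \<le> e"
    using assms(5) i by (intro integral_le_const) auto
  finally show ?thesis .
qed

text \<open>The indicator of a closed set \<open>C\<close> is the decreasing limit of the continuous functions
  \<open>max 0 (1 - k * infdist x C)\<close>, so dominated convergence recovers the measure of closed sets, which
  form a generator stable under intersection.\<close>

lemma borel_prob_measure_eqI:
  fixes \<mu> \<nu> :: "'a::metric_space measure"
  assumes "\<mu> \<in> borel_prob_measures" "\<nu> \<in> borel_prob_measures"
    and eq: "\<And>f :: 'a \<Rightarrow> real. continuous_on UNIV f \<Longrightarrow> integral\<^sup>L \<mu> f = integral\<^sup>L \<nu> f"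
  shows "\<mu> = \<nu>"
proof -
  interpret m: prob_space \<mu> using borel_prob_measuresD[OF assms(1)] by simp
  interpret n: prob_space \<nu> using borel_prob_measuresD[OF assms(2)] by simp
  have lim: "(\<lambda>k. \<integral>x. max 0 (1 - real k * infdist x C) \<partial>\<rho>) \<longlonglongrightarrow> measure \<rho> C"
    if \<rho>: "\<rho> \<in> borel_prob_measures" and C: "closed C" "C \<noteq> {}" for \<rho> :: "'a measure" and C
  proof -
    interpret prob_space \<rho> using borel_prob_measuresD[OF \<rho>] by simp
    have cont: "continuous_on UNIV (\<lambda>x. max 0 (1 - real k * infdist x C))" for k
      by (intro continuous_intros)
    have pw: "(\<lambda>k. max 0 (1 - real k * infdist x C)) \<longlonglongrightarrow> indicat_real C x" for x
    proof (cases "x \<in> C")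
      case True
      then show ?thesis by simp
    next
      case False
      have "infdist x C > 0"
        using False C in_closed_iff_infdist_zero[of C x] infdist_nonneg[of x C] by fastforce
      then obtain k0 :: nat where k0: "1 < real k0 * infdist x C"
        using reals_Archimedean3 by blast
      have "eventually (\<lambda>k. max 0 (1 - real k * infdist x C) = indicat_real C x) sequentially"
      proof (rule eventually_sequentiallyI)
        fix k assume "k0 \<le> k"
        then have "real k0 * infdist x C \<le> real k * infdist x C"
          by (intro mult_right_mono) (auto simp: infdist_nonneg)
        then show "max 0 (1 - real k * infdist x C) = indicat_real C x"
          using k0 False by auto
      qed
      then show ?thesis by (rule tendsto_eventually)
    qed
    have Cs: "C \<in> sets \<rho>" using C borel_prob_measuresD[OF \<rho>] by auto
    have "(\<lambda>k. \<integral>x. max 0 (1 - real k * infdist x C) \<partial>\<rho>) \<longlonglongrightarrow> integral\<^sup>L \<rho> (indicat_real C)"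
    proof (rule integral_dominated_convergence[where w = "\<lambda>_. 1"])
      show "(\<lambda>x. max 0 (1 - real k * infdist x C)) \<in> borel_measurable \<rho>" for k
        using cont borel_prob_measuresD[OF \<rho>] by (intro measurable_continuous) auto
    qed (use pw Cs in \<open>auto simp: infdist_nonneg\<close>)
    then show ?thesis using Cs borel_prob_measuresD(3)[OF \<rho>] by simp
  qed
  have closed_eq: "emeasure \<mu> C = emeasure \<nu> C" if C: "closed C" for C
  proof (cases "C = {}")
    case False
    have "(\<integral>x. max 0 (1 - real k * infdist x C) \<partial>\<mu>) = (\<integral>x. max 0 (1 - real k * infdist x C) \<partial>\<nu>)" for k
      by (intro eq continuous_intros)
    then have "measure \<mu> C = measure \<nu> C"
      using lim[OF assms(1) C False] lim[OF assms(2) C False] LIMSEQ_unique by auto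
    then show ?thesis by (simp add: m.emeasure_eq_measure n.emeasure_eq_measure)
  qed simp
  show ?thesis
  proof (rule measure_eqI_generator_eq[where E = "Collect closed" and \<Omega> = UNIV and A = "\<lambda>_::nat. UNIV"])
    show "Int_stable (Collect closed)" by (auto simp: Int_stable_def)
    show "sets \<mu> = sigma_sets UNIV (Collect closed)" "sets \<nu> = sigma_sets UNIV (Collect closed)"
      using borel_prob_measuresD(2)[OF assms(1)] borel_prob_measuresD(2)[OF assms(2)]
      by (auto simp: borel_eq_closed)
  qed (use closed_eq in auto)
qed

section \<open>Birkhoff averages and empirical measures\<close>

definition birkhoff_average :: "('a \<Rightarrow> 'a) \<Rightarrow> ('a \<Rightarrow> real) \<Rightarrow> nat \<Rightarrow> 'a \<Rightarrow> real" where
  "birkhoff_average T f n x = (\<Sum>j<n. f ((T ^^ j) x)) / real n"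

lemma continuous_funpow:
  fixes T :: "'a::topological_space \<Rightarrow> 'a"
  assumes "continuous_on UNIV T"
  shows "continuous_on UNIV (T ^^ n)"
proof (induction n)
  case (Suc n)
  then have "continuous_on UNIV (T \<circ> (T ^^ n))"
    using assms by (intro continuous_on_compose) (auto intro: continuous_on_subset)
  then show ?case by simp
qed (simp add: id_def)

lemma continuous_comp_funpow:
  fixes f :: "'a::topological_space \<Rightarrow> real" and T :: "'a \<Rightarrow> 'a"
  assumes "continuous_on UNIV T" "continuous_on UNIV f"
  shows "continuous_on UNIV (\<lambda>x. f ((T ^^ n) x))"
  using continuous_on_compose2[OF assms(2) continuous_funpow[OF assms(1)]] by auto

lemma continuous_birkhoff_average:
  fixes f :: "'a::topological_space \<Rightarrow> real" and T :: "'a \<Rightarrow> 'a"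
  assumes "continuous_on UNIV T" "continuous_on UNIV f"
  shows "continuous_on UNIV (birkhoff_average T f n)"
  unfolding birkhoff_average_def
  using continuous_comp_funpow[OF assms] by (cases "n = 0") (auto intro!: continuous_intros)

text \<open>As the image of the uniform distribution on \<open>{..<n}\<close>, the empirical measure is seen to be a
  probability measure, and integrals against it become finite averages.\<close>

lemma empirical_measure_eq_distr:
  assumes "n \<ge> 1"
  shows "empirical_measure T x n =
    distr (measure_pmf (pmf_of_set {..<n})) borel (\<lambda>j. (T ^^ j) x)"
proof (rule measure_eqI)
  fix A assume "A \<in> sets (empirical_measure T x n)"
  then have A: "A \<in> sets borel" by simp
  have ne: "{..<n} \<noteq> {}" using assms by (simp add: lessThan_empty_iff)
  let ?J = "{j. j < n \<and> (T ^^ j) x \<in> A}"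
  have "emeasure (empirical_measure T x n) A =
      ennreal (1 / real n) * (\<Sum>j<n. ennreal (indicat_real A ((T ^^ j) x)))"
    using A by (simp add: emeasure_empirical_measure ennreal_indicator)
  also have "\<dots> = ennreal (1 / real n * (\<Sum>j<n. indicat_real A ((T ^^ j) x)))"
    by (subst sum_ennreal) (auto simp: sum_nonneg simp flip: ennreal_mult)
  also have "(\<Sum>j<n. indicat_real A ((T ^^ j) x)) = real (card ?J)"
    by (simp add: indicator_def sum.If_cases Int_def lessThan_def conj_commute)
  also have "ennreal (1 / real n * real (card ?J)) =
      emeasure (measure_pmf (pmf_of_set {..<n})) ((\<lambda>j. (T ^^ j) x) -` A)"
    using ne by (simp add: emeasure_pmf_of_set Int_def lessThan_def vimage_def)
  finally show "emeasure (empirical_measure T x n) A =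
      emeasure (distr (measure_pmf (pmf_of_set {..<n})) borel (\<lambda>j. (T ^^ j) x)) A"
    using A by (simp add: emeasure_distr)
qed simp

lemma empirical_measure_borel_prob:
  assumes "n \<ge> 1"
  shows "empirical_measure T x n \<in> borel_prob_measures"
  unfolding borel_prob_measures_def empirical_measure_eq_distr[OF assms]
  by (auto intro!: prob_space.prob_space_distr measure_pmf.prob_space_axioms)

lemma integral_empirical_measure:
  fixes f :: "'a::topological_space \<Rightarrow> real"
  assumes "n \<ge> 1" "continuous_on UNIV f"
  shows "integral\<^sup>L (empirical_measure T x n) f = birkhoff_average T f n x"
proof -
  have "{..<n} \<noteq> {}" using assms(1) by (simp add: lessThan_empty_iff)
  then show ?thesis
    using assms(2) unfolding empirical_measure_eq_distr[OF assms(1)] birkhoff_average_def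
    by (subst integral_distr)
       (auto simp: integral_pmf_of_set intro: borel_measurable_continuous_onI)
qed

section \<open>Invariant measures\<close>

lemma invariant_measures_iff:
  fixes T :: "'a::metric_space \<Rightarrow> 'a"
  assumes "continuous_on UNIV T" "\<mu> \<in> borel_prob_measures"
  shows "\<mu> \<in> invariant_measures T \<longleftrightarrow> distr \<mu> borel T = \<mu>"
proof -
  note \<mu> = borel_prob_measuresD[OF assms(2)]
  have T: "T \<in> measurable \<mu> borel"
    using measurable_continuous[OF \<mu>(2) assms(1)] .
  have "distr \<mu> borel T = \<mu> \<longleftrightarrow> (\<forall>A\<in>sets borel. emeasure \<mu> (T -` A) = emeasure \<mu> A)"
  proof
    assume "distr \<mu> borel T = \<mu>"
    then show "\<forall>A\<in>sets borel. emeasure \<mu> (T -` A) = emeasure \<mu> A"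
      using emeasure_distr[OF T] \<mu>(3) by (metis Int_UNIV_right)
  next
    assume "\<forall>A\<in>sets borel. emeasure \<mu> (T -` A) = emeasure \<mu> A"
    then show "distr \<mu> borel T = \<mu>"
      using \<mu> by (intro measure_eqI) (auto simp: emeasure_distr[OF T])
  qed
  then show ?thesis using assms(2) by (simp add: invariant_measures_def)
qed

lemma invariant_integral_comp:
  fixes T :: "'a::metric_space \<Rightarrow> 'a" and f :: "'a \<Rightarrow> real"
  assumes "continuous_on UNIV T" "\<mu> \<in> invariant_measures T" "continuous_on UNIV f"
  shows "(\<integral>x. f (T x) \<partial>\<mu>) = integral\<^sup>L \<mu> f"
proof -
  have \<mu>: "\<mu> \<in> borel_prob_measures" using assms(2) by (simp add: invariant_measures_def)
  have "(\<integral>x. f (T x) \<partial>\<mu>) = integral\<^sup>L (distr \<mu> borel T) f"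
    using measurable_continuous[OF borel_prob_measuresD(2)[OF \<mu>] assms(1)] assms(3)
    by (intro integral_distr[symmetric]) (auto intro: borel_measurable_continuous_onI)
  then show ?thesis using invariant_measures_iff[OF assms(1) \<mu>] assms(2) by simp
qed

lemma integral_birkhoff_average:
  fixes T :: "'a::metric_space \<Rightarrow> 'a" and f :: "'a \<Rightarrow> real"
  assumes "compact (UNIV :: 'a set)" "continuous_on UNIV T" "\<mu> \<in> invariant_measures T"
    "continuous_on UNIV f" "n \<ge> 1"
  shows "integral\<^sup>L \<mu> (birkhoff_average T f n) = integral\<^sup>L \<mu> f"
proof -
  have \<mu>: "\<mu> \<in> borel_prob_measures" using assms(3) by (simp add: invariant_measures_def)
  have step: "(\<integral>x. f ((T ^^ j) x) \<partial>\<mu>) = integral\<^sup>L \<mu> f" for j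
  proof (induction j)
    case (Suc j)
    have "(\<integral>x. f ((T ^^ Suc j) x) \<partial>\<mu>) = (\<integral>x. f ((T ^^ j) (T x)) \<partial>\<mu>)"
      by (simp add: funpow_swap1)
    also have "\<dots> = (\<integral>x. f ((T ^^ j) x) \<partial>\<mu>)"
      using invariant_integral_comp[OF assms(2,3) continuous_comp_funpow[OF assms(2,4)]] .
    finally show ?case using Suc by simp
  qed simp
  have "integral\<^sup>L \<mu> (birkhoff_average T f n) = (\<Sum>j<n. \<integral>x. f ((T ^^ j) x) \<partial>\<mu>) / real n"
    unfolding birkhoff_average_def
    using integrable_continuous[OF assms(1) \<mu> continuous_comp_funpow[OF assms(2,4)]]
    by (simp add: Bochner_Integration.integral_sum)
  then show ?thesis using step assms(5) by simp
qed

text \<open>By telescoping, averaging \<open>f \<circ> T\<close> instead of \<open>f\<close> changes the average by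
  \<open>(f (T\<^sup>n x) - f x) / n\<close>, which tends to zero as \<open>f\<close> is bounded. Hence a limit measure and its image
  under \<open>T\<close> have the same integrals.\<close>

lemma limit_measures_invariant:
  fixes T :: "'a::metric_space \<Rightarrow> 'a"
  assumes "compact (UNIV :: 'a set)" "continuous_on UNIV T"
  shows "limit_measures T x \<subseteq> invariant_measures T"
proof
  fix \<mu> assume "\<mu> \<in> limit_measures T x"
  then obtain r where r: "strict_mono r" "\<forall>k. r k \<ge> 1"
    "limitin weak_star_topology (\<lambda>k. empirical_measure T x (r k)) \<mu> sequentially"
    by (auto simp: limit_measures_def)
  have \<mu>: "\<mu> \<in> borel_prob_measures" and
    lim: "\<And>f::'a \<Rightarrow> real. continuous_on UNIV f \<Longrightarrow>
      (\<lambda>k. birkhoff_average T f (r k) x) \<longlonglongrightarrow> integral\<^sup>L \<mu> f"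
    using r(2,3) limitin_weak_star_iff[of "\<lambda>k. empirical_measure T x (r k)" \<mu> sequentially]
    by (auto simp: empirical_measure_borel_prob integral_empirical_measure)
  note T = measurable_continuous[OF borel_prob_measuresD(2)[OF \<mu>] assms(2)]
  have "integral\<^sup>L (distr \<mu> borel T) f = integral\<^sup>L \<mu> f" if f: "continuous_on UNIV f" for f :: "'a \<Rightarrow> real"
  proof -
    have fT: "continuous_on UNIV (\<lambda>x. f (T x))"
      using continuous_comp_funpow[OF assms(2) f, of 1] by simp
    obtain B where B: "B > 0" "\<And>x. \<bar>f x\<bar> \<le> B" using compact_bound[OF assms(1) f] by auto
    have diff: "birkhoff_average T (\<lambda>x. f (T x)) n x - birkhoff_average T f n x =
        (f ((T ^^ n) x) - f x) / real n" for n
      using sum_lessThan_telescope[of "\<lambda>j. f ((T ^^ j) x)" n]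
      by (simp add: birkhoff_average_def sum_subtractf flip: diff_divide_distrib)
    have B0: "(\<lambda>k. 2 * B / real (r k)) \<longlonglongrightarrow> 0"
      using LIMSEQ_subseq_LIMSEQ[OF lim_const_over_n r(1), of "2 * B"] by (simp add: o_def)
    have Bk: "\<bar>birkhoff_average T (\<lambda>x. f (T x)) (r k) x - birkhoff_average T f (r k) x\<bar>
        \<le> 2 * B / real (r k)" for k
      unfolding diff using B(2)[of "(T ^^ r k) x"] B(2)[of x]
      by (auto simp: abs_divide intro!: divide_right_mono)
    have "(\<lambda>k. birkhoff_average T (\<lambda>x. f (T x)) (r k) x - birkhoff_average T f (r k) x)
        \<longlonglongrightarrow> 0"
      by (rule Lim_null_comparison[OF always_eventually B0]) (simp only: real_norm_def Bk simp_thms)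
    moreover have "(\<lambda>k. birkhoff_average T (\<lambda>x. f (T x)) (r k) x - birkhoff_average T f (r k) x)
        \<longlonglongrightarrow> (\<integral>x. f (T x) \<partial>\<mu>) - integral\<^sup>L \<mu> f"
      by (intro tendsto_diff lim f fT)
    ultimately have "(\<integral>x. f (T x) \<partial>\<mu>) - integral\<^sup>L \<mu> f = 0"
      by (intro LIMSEQ_unique)
    then have "(\<integral>x. f (T x) \<partial>\<mu>) = integral\<^sup>L \<mu> f" by simp
    then show ?thesis
      using f by (subst integral_distr[OF T]) (auto intro: borel_measurable_continuous_onI)
  qed
  moreover have "distr \<mu> borel T \<in> borel_prob_measures"
    using T borel_prob_measuresD[OF \<mu>]
    by (auto simp: borel_prob_measures_def intro!: prob_space.prob_space_distr)
  ultimately have "distr \<mu> borel T = \<mu>"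
    using \<mu> by (intro borel_prob_measure_eqI) auto
  then show "\<mu> \<in> invariant_measures T" using invariant_measures_iff[OF assms(2) \<mu>] by simp
qed

section \<open>Approximating a measure by finitely many points\<close>

lemma sum_list_concat_replicate:
  "sum_list (map f (concat (map (\<lambda>i. replicate (m i) (s i)) [0..<p]))) =
    (\<Sum>i<p. real (m i) * (f (s i) :: real))"
proof (induction p)
  case (Suc p)
  have "sum_list (map f (replicate k y)) = real k * f y" for k y
    by (induction k) (auto simp: algebra_simps)
  then show ?case using Suc by simp
qed simp

text \<open>Integrating a partition of unity turns \<open>\<mu>\<close> into finitely many points \<open>s i\<close> with weights \<open>w i\<close>.
  Listing \<open>s i\<close> with multiplicity \<open>\<lceil>M * w i\<rceil>\<close> realises the weights up to rounding errors of at most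
  \<open>p\<close> in total, which are absorbed by a large \<open>M\<close>.\<close>

lemma finite_point_approx:
  fixes F :: "('a::metric_space \<Rightarrow> real) set"
  assumes "compact (UNIV :: 'a set)" "\<mu> \<in> borel_prob_measures" "finite F"
    and F: "\<And>f. f \<in> F \<Longrightarrow> continuous_on UNIV f" "\<And>f x. f \<in> F \<Longrightarrow> \<bar>f x\<bar> \<le> 1"
    and "\<epsilon> > 0"
  shows "\<exists>ys. ys \<noteq> [] \<and> (\<forall>f\<in>F. \<bar>sum_list (map f ys) - real (length ys) * integral\<^sup>L \<mu> f\<bar> \<le> \<epsilon> * real (length ys))"
proof -
  interpret prob_space \<mu> using borel_prob_measuresD[OF assms(2)] by simp
  obtain \<delta> where \<delta>: "\<delta> > 0" "\<forall>f\<in>F. \<forall>x y. dist x y < \<delta> \<longrightarrow> \<bar>f x - f y\<bar> < \<epsilon> / 2"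
    using uniform_modulus[OF assms(1,3) F(1), of "\<epsilon> / 2"] assms(6) by auto
  obtain p and s :: "nat \<Rightarrow> 'a" and \<phi> where \<phi>: "\<And>i. continuous_on UNIV (\<phi> i :: 'a \<Rightarrow> real)"
    "\<And>i x. 0 \<le> \<phi> i x" "\<And>i x. \<phi> i x \<le> 1" "\<And>x. (\<Sum>i<p. \<phi> i x) = 1"
    "\<And>i x. i < p \<Longrightarrow> \<phi> i x \<noteq> 0 \<Longrightarrow> dist x (s i) < \<delta>"
    using partition_of_unity[OF assms(1) \<delta>(1)] by metis
  define w where "w i = integral\<^sup>L \<mu> (\<phi> i)" for i
  have int: "integrable \<mu> (\<phi> i)" for i
    by (intro integrable_continuous assms \<phi>)
  have w0: "0 \<le> w i" for i
    unfolding w_def using \<phi>(2) by (intro integral_nonneg_AE) auto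
  have w1: "(\<Sum>i<p. w i) = 1"
  proof -
    have "(\<Sum>i<p. w i) = (\<integral>x. (\<Sum>i<p. \<phi> i x) \<partial>\<mu>)"
      unfolding w_def using int by (simp add: Bochner_Integration.integral_sum)
    then show ?thesis using \<phi>(4) by (simp add: prob_space)
  qed
  obtain M :: nat where M: "real M > 4 * real p / \<epsilon>" "M > 0"
    by (metis reals_Archimedean2 less_trans max_less_iff_conj of_nat_0_less_iff)
  define m where "m i = nat \<lceil>real M * w i\<rceil>" for i
  have m: "real M * w i \<le> real (m i)" "real (m i) \<le> real M * w i + 1" for i
    using w0[of i] mult_nonneg_nonneg[of "real M" "w i"] unfolding m_def by linarith+
  define ys where "ys = concat (map (\<lambda>i. replicate (m i) (s i)) [0..<p])"
  have len: "real (length ys) = (\<Sum>i<p. real (m i))"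
    using sum_list_concat_replicate[of "\<lambda>_. 1" m s p] unfolding ys_def[symmetric]
    by (simp add: sum_list_triv)
  have len1: "real M \<le> real (length ys)"
  proof -
    have "real M = (\<Sum>i<p. real M * w i)" using w1 by (simp flip: sum_distrib_left)
    then show ?thesis unfolding len using m(1) by (metis sum_mono)
  qed
  have len2: "real (length ys) \<le> real M + real p"
  proof -
    have "(\<Sum>i<p. real (m i)) \<le> (\<Sum>i<p. real M * w i + 1)" using m by (intro sum_mono)
    then show ?thesis using w1 len by (simp add: sum.distrib flip: sum_distrib_left)
  qed
  have "\<bar>sum_list (map f ys) - real (length ys) * integral\<^sup>L \<mu> f\<bar> \<le> \<epsilon> * real (length ys)"
    if f: "f \<in> F" for f
  proof -
    let ?I = "integral\<^sup>L \<mu> f" and ?S = "\<Sum>i<p. f (s i) * w i"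
    have I1: "\<bar>?I\<bar> \<le> 1"
      using integral_diff_bound[OF assms(1,2) F(1)[OF f], of "\<lambda>_. 0" 1] F(2)[OF f] by simp
    have IS: "\<bar>?I - ?S\<bar> \<le> \<epsilon> / 2"
    proof -
      have "?S = (\<integral>x. (\<Sum>i<p. f (s i) * \<phi> i x) \<partial>\<mu>)"
        unfolding w_def using int by (simp add: Bochner_Integration.integral_sum)
      moreover have "\<bar>f x - (\<Sum>i<p. f (s i) * \<phi> i x)\<bar> \<le> \<epsilon> / 2" for x
        by (rule partition_of_unity_approx[where \<delta> = \<delta> and s = s]) (use \<phi> \<delta>(2) f assms(6) in auto)
      ultimately show ?thesis
        using integral_diff_bound[OF assms(1,2) F(1)[OF f], of "\<lambda>x. \<Sum>i<p. f (s i) * \<phi> i x" "\<epsilon> / 2"] \<phi>(1)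
        by (simp add: continuous_on_sum continuous_on_mult_left)
    qed
    have "sum_list (map f ys) - real M * ?S = (\<Sum>i<p. (real (m i) - real M * w i) * f (s i))"
      unfolding ys_def sum_list_concat_replicate
      by (simp add: sum_distrib_left sum_subtractf algebra_simps)
    also have "\<bar>\<dots>\<bar> \<le> (\<Sum>i<p. 1)"
    proof (rule sum_abs[THEN order_trans], rule sum_mono)
      fix i
      show "\<bar>(real (m i) - real M * w i) * f (s i)\<bar> \<le> 1"
        using m[of i] F(2)[OF f, of "s i"] unfolding abs_mult by (intro mult_le_one) auto
    qed
    finally have a: "\<bar>sum_list (map f ys) - real M * ?S\<bar> \<le> real p" by simp
    have b: "\<bar>real M * ?S - real M * ?I\<bar> \<le> real M * (\<epsilon> / 2)"
    proof -
      have "\<bar>real M * ?S - real M * ?I\<bar> = real M * \<bar>?I - ?S\<bar>"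
        by (simp add: abs_mult abs_minus_commute flip: right_diff_distrib)
      also have "\<dots> \<le> real M * (\<epsilon> / 2)" using IS by (intro mult_left_mono) auto
      finally show ?thesis .
    qed
    have c: "\<bar>real M * ?I - real (length ys) * ?I\<bar> \<le> real p"
    proof -
      have "\<bar>real M * ?I - real (length ys) * ?I\<bar> = \<bar>real M - real (length ys)\<bar> * \<bar>?I\<bar>"
        by (simp add: abs_mult flip: left_diff_distrib)
      also have "\<dots> \<le> real p * 1"
        using len1 len2 I1 by (intro mult_mono) auto
      finally show ?thesis by simp
    qed
    have "2 * real p \<le> real M * (\<epsilon> / 2)" using M assms(6) by (simp add: field_simps)
    moreover have "\<epsilon> * real M \<le> \<epsilon> * real (length ys)" using len1 assms(6) by simp
    moreover have tri: "\<bar>a - d\<bar> \<le> \<bar>a - b\<bar> + \<bar>b - c\<bar> + \<bar>c - d\<bar>" for a b c d :: real by linarith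
    from tri[of "sum_list (map f ys)" "real (length ys) * ?I" "real M * ?S" "real M * ?I"]
    have "\<bar>sum_list (map f ys) - real (length ys) * ?I\<bar> \<le> real M * (\<epsilon> / 2) + 2 * real p"
      by (rule order_trans) (use add_mono[OF add_mono[OF a b] c] in simp)
    moreover have "real M * (\<epsilon> / 2) + real M * (\<epsilon> / 2) = \<epsilon> * real M" by (simp add: field_simps)
    ultimately show ?thesis by linarith
  qed
  moreover have "ys \<noteq> []" using len1 M(2) by auto
  ultimately show ?thesis by blast
qed

section \<open>Pseudo-orbits through prescribed orbit segments\<close>

text \<open>Up to an error of half of \<open>\<delta>\<close>, the points \<open>a\<close> and \<open>b\<close> may be replaced by centres from a finite
  cover, and transitivity is then applied to finitely many pairs of centres. This makes \<open>L\<close>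
  independent of \<open>a\<close> and \<open>b\<close>.\<close>

lemma bounded_links:
  fixes T :: "'a::metric_space \<Rightarrow> 'a"
  assumes "compact (UNIV :: 'a set)" "topologically_transitive T" "\<delta> > 0"
  shows "\<exists>L. \<forall>a b. \<exists>c l. 1 \<le> l \<and> l \<le> L \<and> dist a c < \<delta> \<and> dist ((T ^^ l) c) b < \<delta>"
proof -
  obtain S :: "'a set" where S: "finite S" "UNIV \<subseteq> (\<Union>x\<in>S. ball x (\<delta> / 2))"
    using finite_ball_cover[OF assms(1), of "\<delta> / 2"] assms(3) by auto
  have "\<exists>l c. 1 \<le> l \<and> c \<in> ball a (\<delta> / 2) \<and> (T ^^ l) c \<in> ball b (\<delta> / 2)" for a b
    using assms(2)[unfolded topologically_transitive_def, rule_format, of "ball a (\<delta> / 2)" "ball b (\<delta> / 2)"]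
      assms(3) by (auto; blast)
  then obtain l c where lc: "\<And>a b. 1 \<le> l a b" "\<And>a b. c a b \<in> ball a (\<delta> / 2)"
    "\<And>a b. (T ^^ l a b) (c a b) \<in> ball b (\<delta> / 2)"
    by metis
  define L where "L = Max ((\<lambda>(a, b). l a b) ` (S \<times> S))"
  have "\<exists>c l. 1 \<le> l \<and> l \<le> L \<and> dist a c < \<delta> \<and> dist ((T ^^ l) c) b < \<delta>" for a b
  proof -
    have "a \<in> (\<Union>x\<in>S. ball x (\<delta> / 2))" "b \<in> (\<Union>x\<in>S. ball x (\<delta> / 2))"
      using S(2) by blast+
    then obtain a' b' where ab: "a' \<in> S" "b' \<in> S" "dist a' a < \<delta> / 2" "dist b' b < \<delta> / 2"
      unfolding UN_iff mem_ball by blast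
    have "l a' b' \<le> L" unfolding L_def using S(1) ab by (intro Max_ge) auto
    moreover have "dist a (c a' b') < \<delta>"
      using lc(2)[of a' b'] ab(3) dist_triangle_half_r[of a' a \<delta> "c a' b'"] by simp
    moreover have "dist ((T ^^ l a' b') (c a' b')) b < \<delta>"
      using lc(3)[of a' b'] ab(4) dist_triangle_half_r[of b' _ \<delta> b] by simp
    ultimately show ?thesis using lc(1) by blast
  qed
  then show ?thesis by blast
qed

definition prepend_orbit :: "('a \<Rightarrow> 'a) \<Rightarrow> 'a \<Rightarrow> nat \<Rightarrow> (nat \<Rightarrow> 'a) \<Rightarrow> nat \<Rightarrow> 'a" where
  "prepend_orbit T c l p j = (if j < l then (T ^^ j) c else p (j - l))"

lemma prepend_orbit_0: "l \<ge> 1 \<Longrightarrow> prepend_orbit T c l p 0 = c"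
  by (simp add: prepend_orbit_def)

lemma prepend_orbit_pseudo:
  fixes T :: "'a::metric_space \<Rightarrow> 'a"
  assumes "\<And>j. dist (T (p j)) (p (Suc j)) < \<delta>" "dist ((T ^^ l) c) (p 0) < \<delta>" "\<delta> > 0"
  shows "dist (T (prepend_orbit T c l p j)) (prepend_orbit T c l p (Suc j)) < \<delta>"
proof -
  consider "Suc j < l" | "Suc j = l" | "l \<le> j" by linarith
  then show ?thesis
  proof cases
    case 2
    then show ?thesis using assms(2) by (auto simp: prepend_orbit_def)
  next
    case 3
    then show ?thesis using assms(1)[of "j - l"] by (simp add: prepend_orbit_def Suc_diff_le)
  qed (use assms in \<open>auto simp: prepend_orbit_def\<close>)
qed

lemma prepend_orbit_sum:
  fixes f :: "'a \<Rightarrow> real"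
  shows "(\<Sum>j<l + t. f (prepend_orbit T c l p j)) = (\<Sum>j<l. f ((T ^^ j) c)) + (\<Sum>j<t. f (p j))"
proof -
  have "(\<Sum>j<l + t. f (prepend_orbit T c l p j)) =
      (\<Sum>j<l. f (prepend_orbit T c l p j)) + (\<Sum>j<t. f (prepend_orbit T c l p (l + j)))"
    by (induction t) (auto simp: algebra_simps)
  then show ?thesis by (simp add: prepend_orbit_def)
qed

text \<open>The segments are put together from the last one to the first, so the statement is proved for
  every starting point \<open>a\<close>: in the induction step \<open>a\<close> becomes the end of the segment that has just been
  prepended. After the last segment the pseudo-orbit continues as a true orbit. The sum over time
  \<open>t\<close> differs from the sum over the segments by the contribution of the links.\<close>

lemma pseudo_orbit_through_segments:
  fixes T :: "'a::metric_space \<Rightarrow> 'a"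
  assumes links: "\<And>a b. \<exists>c l. 1 \<le> l \<and> l \<le> L \<and> dist a c < \<delta> \<and> dist ((T ^^ l) c) b < \<delta>"
    and "\<delta> > 0" "n \<ge> 1"
  shows "\<exists>p t. dist a (p 0) < \<delta> \<and> (\<forall>j. dist (T (p j)) (p (Suc j)) < \<delta>) \<and>
    n * length ys \<le> t \<and> t \<le> (n + L) * length ys \<and>
    (\<forall>f :: 'a \<Rightarrow> real. (\<forall>x. \<bar>f x\<bar> \<le> 1) \<longrightarrow>
      \<bar>(\<Sum>j<t. f (p j)) - sum_list (map (\<lambda>y. \<Sum>j<n. f ((T ^^ j) y)) ys)\<bar> \<le> real L * real (length ys))"
proof (induction ys arbitrary: a)
  case Nil
  show ?case
    using assms(2) by (intro exI[of _ "\<lambda>j. (T ^^ j) a"] exI[of _ 0]) auto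
next
  case (Cons y ys)
  obtain p t where p: "dist ((T ^^ n) y) (p 0) < \<delta>" "\<And>j. dist (T (p j)) (p (Suc j)) < \<delta>"
    and t: "n * length ys \<le> t" "t \<le> (n + L) * length ys"
    and sum: "\<And>f :: 'a \<Rightarrow> real. (\<And>x. \<bar>f x\<bar> \<le> 1) \<Longrightarrow>
      \<bar>(\<Sum>j<t. f (p j)) - sum_list (map (\<lambda>y. \<Sum>j<n. f ((T ^^ j) y)) ys)\<bar> \<le> real L * real (length ys)"
    using Cons.IH[of "(T ^^ n) y"] by blast
  obtain c l where c: "1 \<le> l" "l \<le> L" "dist a c < \<delta>" "dist ((T ^^ l) c) y < \<delta>"
    using links by blast
  define p' where "p' = prepend_orbit T y n p"
  define q where "q = prepend_orbit T c l p'"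
  have p': "dist (T (p' j)) (p' (Suc j)) < \<delta>" for j
    unfolding p'_def using p assms(2) by (intro prepend_orbit_pseudo) auto
  have p'0: "p' 0 = y" unfolding p'_def using assms(3) by (simp add: prepend_orbit_0)
  have q: "dist (T (q j)) (q (Suc j)) < \<delta>" for j
    unfolding q_def using p' p'0 c assms(2) by (intro prepend_orbit_pseudo) auto
  have q0: "q 0 = c" unfolding q_def using c(1) by (simp add: prepend_orbit_0)
  have "\<bar>(\<Sum>j<l + (n + t). f (q j)) - sum_list (map (\<lambda>y. \<Sum>j<n. f ((T ^^ j) y)) (y # ys))\<bar>
      \<le> real L * real (length (y # ys))" if f: "\<And>x. \<bar>f x\<bar> \<le> 1" for f :: "'a \<Rightarrow> real"
  proof -
    have "\<bar>\<Sum>j<l. f ((T ^^ j) c)\<bar> \<le> (\<Sum>j<l. 1)"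
      by (rule sum_abs[THEN order_trans], rule sum_mono) (rule f)
    then have "\<bar>\<Sum>j<l. f ((T ^^ j) c)\<bar> \<le> real L" using c(2) by simp
    then show ?thesis
      using sum[of f] f unfolding q_def p'_def prepend_orbit_sum by (simp add: algebra_simps)
  qed
  moreover have "n * length (y # ys) \<le> l + (n + t)" "l + (n + t) \<le> (n + L) * length (y # ys)"
    using t c(2) by auto
  ultimately show ?case using q q0 c(3) by (intro exI[of _ q] exI[of _ "l + (n + t)"]) auto
qed

section \<open>Density of points with prescribed averages\<close>

text \<open>The order of choices matters: \<open>\<eta>\<close> from uniform continuity and the open set, then \<open>\<delta>\<close> from
  shadowing, then the link length \<open>L\<close>, then \<open>n\<close> with \<open>L / n\<close> small, and finally the points \<open>ys\<close>, which
  depend on \<open>n\<close>. Four errors of size \<open>\<epsilon> / 5\<close> arise: from shadowing, from the links in the sum, from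
  replacing \<open>\<mu>\<close> by \<open>ys\<close>, and from the difference between \<open>t\<close> and \<open>n * m\<close>.\<close>

lemma dense_prescribed_averages:
  fixes T :: "'a::metric_space \<Rightarrow> 'a" and F :: "('a \<Rightarrow> real) set"
  assumes X: "compact (UNIV :: 'a set)" and T: "continuous_on UNIV T" "topologically_transitive T"
    and sh: "shadowing_property T" and \<mu>: "\<mu> \<in> invariant_measures T"
    and F: "finite F" "\<And>f. f \<in> F \<Longrightarrow> continuous_on UNIV f" "\<And>f x. f \<in> F \<Longrightarrow> \<bar>f x\<bar> \<le> 1"
    and e: "\<epsilon> > 0" and U: "open U" "U \<noteq> {}"
  shows "\<exists>z\<in>U. \<exists>n\<ge>N. \<forall>f\<in>F. \<bar>birkhoff_average T f n z - integral\<^sup>L \<mu> f\<bar> < \<epsilon>"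
proof -
  have \<mu>': "\<mu> \<in> borel_prob_measures" using \<mu> by (simp add: invariant_measures_def)
  define e' where "e' = \<epsilon> / 5"
  have e': "e' > 0" using e by (simp add: e'_def)
  obtain u r where u: "r > 0" "ball u r \<subseteq> U"
    using U by (metis all_not_in_conv open_contains_ball)
  obtain \<eta>1 where \<eta>1: "\<eta>1 > 0" "\<forall>f\<in>F. \<forall>x y. dist x y < \<eta>1 \<longrightarrow> \<bar>f x - f y\<bar> < e'"
    using uniform_modulus[OF X F(1,2) e'] by auto
  define \<eta> where "\<eta> = min \<eta>1 (r / 2)"
  have \<eta>: "\<eta> > 0" "\<eta> \<le> \<eta>1" "\<eta> \<le> r / 2" using \<eta>1 u by (auto simp: \<eta>_def)
  obtain \<delta>1 where \<delta>1: "\<delta>1 > 0" "\<And>x. pseudo_orbit T \<delta>1 x \<Longrightarrow> shadowed T \<eta> x"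
    using sh \<eta>(1) unfolding shadowing_property_def by blast
  define \<delta> where "\<delta> = min \<delta>1 (r / 2)"
  have \<delta>: "\<delta> > 0" "\<delta> \<le> \<delta>1" "\<delta> \<le> r / 2" using \<delta>1 u by (auto simp: \<delta>_def)
  obtain L where L: "\<And>a b. \<exists>c l. 1 \<le> l \<and> l \<le> L \<and> dist a c < \<delta> \<and> dist ((T ^^ l) c) b < \<delta>"
    using bounded_links[OF X T(2) \<delta>(1)] by blast
  obtain n :: nat where n0: "real n > max (real L / e') (real (max N 1))"
    using reals_Archimedean2 by blast
  then have n: "real L \<le> e' * real n" "n \<ge> N" "n \<ge> 1"
    using e' by (auto simp: field_simps)
  let ?A = "\<lambda>f. birkhoff_average T f n"
  have A1: "\<bar>?A f x\<bar> \<le> 1" if "f \<in> F" for f x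
  proof -
    have "\<bar>\<Sum>j<n. f ((T ^^ j) x)\<bar> \<le> (\<Sum>j<n. 1)"
      by (rule sum_abs[THEN order_trans], rule sum_mono) (rule F(3)[OF that])
    then show ?thesis using n(3) by (simp add: birkhoff_average_def)
  qed
  obtain ys where ys: "ys \<noteq> []" "\<forall>h\<in>?A ` F.
      \<bar>sum_list (map h ys) - real (length ys) * integral\<^sup>L \<mu> h\<bar> \<le> e' * real (length ys)"
    using finite_point_approx[OF X \<mu>' finite_imageI[OF F(1)], of ?A e']
      continuous_birkhoff_average[OF T(1) F(2)] A1 e' by blast
  define m where "m = length ys"
  have m: "m \<ge> 1" using ys(1) by (simp add: m_def Suc_le_eq)
  obtain p t where p: "dist u (p 0) < \<delta>" "\<And>j. dist (T (p j)) (p (Suc j)) < \<delta>"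
    and t: "n * m \<le> t" "t \<le> (n + L) * m"
    and sum: "\<And>f :: 'a \<Rightarrow> real. (\<And>x. \<bar>f x\<bar> \<le> 1) \<Longrightarrow>
      \<bar>(\<Sum>j<t. f (p j)) - sum_list (map (\<lambda>y. \<Sum>j<n. f ((T ^^ j) y)) ys)\<bar> \<le> real L * real m"
    using pseudo_orbit_through_segments[OF L \<delta>(1) n(3), of u ys] unfolding m_def by blast
  \<comment> \<open>Shadowing counts from time 1, so the shifted sequence is shadowed by \<open>y\<close>, and the point that
    starts close to \<open>p 0\<close> is \<open>T y\<close>.\<close>
  have "pseudo_orbit T \<delta>1 (\<lambda>j. p (j - 1))"
    unfolding pseudo_orbit_def
  proof (intro allI impI)
    fix k :: nat assume "1 \<le> k"
    then show "dist (T (p (k - 1))) (p (Suc k - 1)) < \<delta>1"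
      using p(2)[of "k - 1"] \<delta>(2) by simp
  qed
  then obtain y where y: "\<And>k. k \<ge> 1 \<Longrightarrow> dist ((T ^^ k) y) (p (k - 1)) < \<eta>"
    using \<delta>1(2) unfolding shadowed_def by blast
  define z where "z = T y"
  have z: "dist ((T ^^ j) z) (p j) < \<eta>" for j
    using y[of "Suc j"] by (simp add: z_def funpow_swap1)
  have "dist u z \<le> dist u (p 0) + dist z (p 0)" by (rule dist_triangle2)
  also have "\<dots> < r" using p(1) z[of 0] \<delta> \<eta> by simp
  finally have "z \<in> U" using u by auto
  have nt: "n \<le> t" using m t(1) by (metis dual_order.trans mult.right_neutral mult_le_mono2)
  have tpos: "real t > 0" using nt n(3) by linarith
  have nm: "real n * real m \<le> real t" "real t \<le> (real n + real L) * real m"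
    using t unfolding of_nat_mult[symmetric] of_nat_add[symmetric] of_nat_le_iff by auto
  have Lm: "real L * real m \<le> e' * real t"
  proof -
    have "real L * real m \<le> e' * real n * real m" using n(1) by (intro mult_right_mono) auto
    also have "\<dots> \<le> e' * real t" using nm(1) e' by (simp add: mult.assoc)
    finally show ?thesis .
  qed
  have "\<bar>birkhoff_average T f t z - integral\<^sup>L \<mu> f\<bar> < \<epsilon>" if f: "f \<in> F" for f
  proof -
    let ?I = "integral\<^sup>L \<mu> f"
    let ?Z = "\<Sum>j<t. f ((T ^^ j) z)" and ?P = "\<Sum>j<t. f (p j)"
    let ?Y = "sum_list (map (\<lambda>y. \<Sum>j<n. f ((T ^^ j) y)) ys)"
    have I1: "\<bar>?I\<bar> \<le> 1"
      using integral_diff_bound[OF X \<mu>' F(2)[OF f], of "\<lambda>_. 0" 1] F(3)[OF f] by simp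
    have "\<bar>?Z - ?P\<bar> \<le> (\<Sum>j<t. e')"
      unfolding sum_subtractf[symmetric]
    proof (rule sum_abs[THEN order_trans], rule sum_mono)
      fix j
      have "dist ((T ^^ j) z) (p j) < \<eta>1" using z[of j] \<eta>(2) by linarith
      then show "\<bar>f ((T ^^ j) z) - f (p j)\<bar> \<le> e'" using \<eta>1(2) f less_imp_le by blast
    qed
    then have a: "\<bar>?Z - ?P\<bar> \<le> e' * real t" by (simp add: mult.commute)
    have b: "\<bar>?P - ?Y\<bar> \<le> e' * real t" using sum[of f] F(3)[OF f] Lm by force
    have c: "\<bar>?Y - real n * real m * ?I\<bar> \<le> e' * real t"
    proof -
      have "(\<lambda>y. \<Sum>j<n. f ((T ^^ j) y)) = (\<lambda>y. real n * ?A f y)"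
        using n(3) by (simp add: birkhoff_average_def)
      then have Y: "?Y = real n * sum_list (map (?A f) ys)"
        by (simp only: sum_list_const_mult)
      have "\<bar>sum_list (map (?A f) ys) - real m * ?I\<bar> \<le> e' * real m"
        using ys(2) f integral_birkhoff_average[OF X T(1) \<mu> F(2)[OF f] n(3)] by (auto simp: m_def)
      then have "real n * \<bar>sum_list (map (?A f) ys) - real m * ?I\<bar> \<le> real n * (e' * real m)"
        by (intro mult_left_mono) auto
      moreover have "\<bar>?Y - real n * real m * ?I\<bar> = real n * \<bar>sum_list (map (?A f) ys) - real m * ?I\<bar>"
        unfolding Y by (simp add: abs_mult mult.assoc flip: right_diff_distrib)
      moreover have "real n * (e' * real m) \<le> e' * real t"
        using nm(1) e' by (simp add: mult.left_commute)
      ultimately show ?thesis by linarith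
    qed
    have d: "\<bar>real n * real m * ?I - real t * ?I\<bar> \<le> e' * real t"
    proof -
      have "\<bar>real n * real m * ?I - real t * ?I\<bar> = \<bar>real n * real m - real t\<bar> * \<bar>?I\<bar>"
        by (simp add: abs_mult flip: left_diff_distrib)
      also have "\<dots> \<le> (real L * real m) * 1"
        using nm I1 by (intro mult_mono) (auto simp: algebra_simps)
      finally show ?thesis using Lm by simp
    qed
    have "\<bar>a - e\<bar> \<le> \<bar>a - b\<bar> + \<bar>b - c\<bar> + \<bar>c - d\<bar> + \<bar>d - e\<bar>" for a b c d e :: real by linarith
    from this[of ?Z "real t * ?I" ?P ?Y "real n * real m * ?I"]
    have "\<bar>?Z - real t * ?I\<bar> \<le> 4 * (e' * real t)"
      using add_mono[OF add_mono[OF add_mono[OF a b] c] d] by simp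
    also have "\<dots> < \<epsilon> * real t" using e tpos by (simp add: e'_def)
    finally have "\<bar>?Z - real t * ?I\<bar> < \<epsilon> * real t" .
    moreover have "birkhoff_average T f t z - ?I = (?Z - real t * ?I) / real t"
      using tpos by (simp add: birkhoff_average_def field_simps)
    ultimately show ?thesis using tpos by (simp add: abs_divide divide_less_eq)
  qed
  moreover have "t \<ge> N" using nt n(2) by simp
  ultimately show ?thesis using \<open>z \<in> U\<close> by blast
qed

section \<open>Generic points\<close>

text \<open>The bound \<open>3 / (K + 1)\<close> couples the number of tested functions with the precision, so a single
  increasing sequence of times works for all \<open>g k\<close>; uniform approximation extends the convergence to
  every continuous function.\<close>

lemma limit_measuresI:
  fixes T :: "'a::metric_space \<Rightarrow> 'a"
  assumes X: "compact (UNIV :: 'a set)" and T: "continuous_on UNIV T" and \<mu>: "\<mu> \<in> borel_prob_measures"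
    and g: "\<And>k. continuous_on UNIV (g k)"
    and total: "\<And>f \<epsilon>. continuous_on UNIV f \<Longrightarrow> \<epsilon> > 0 \<Longrightarrow>
      \<exists>p \<sigma> c. \<forall>x :: 'a. \<bar>f x - (\<Sum>i<(p::nat). c i * g (\<sigma> i) x)\<bar> \<le> \<epsilon>"
    and ev: "\<And>K N :: nat. \<exists>n\<ge>N. \<forall>k<K. \<bar>birkhoff_average T (g k) n x - integral\<^sup>L \<mu> (g k)\<bar> < 3 / real (Suc K)"
  shows "\<mu> \<in> limit_measures T x"
proof -
  let ?Q = "\<lambda>K n. n \<ge> 1 \<and> (\<forall>k<K. \<bar>birkhoff_average T (g k) n x - integral\<^sup>L \<mu> (g k)\<bar> < 3 / real (Suc K))"
  have Q: "\<exists>n\<ge>N. ?Q K n" for K N :: nat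
    using ev[of "max N 1" K] by (meson max.bounded_iff)
  have "\<exists>r. \<forall>K. ?Q K (r K) \<and> r K < r (Suc K)"
  proof (rule dependent_nat_choice)
    show "\<exists>n. ?Q 0 n" using Q[of 0 0] by blast
    show "\<exists>n'. ?Q (Suc K) n' \<and> n < n'" for K n
      using Q[of "Suc n" "Suc K"] by (meson Suc_le_lessD)
  qed
  then obtain r where r: "\<And>K. ?Q K (r K)" "\<And>K. r K < r (Suc K)" by blast
  have mono: "strict_mono r" using r(2) by (simp add: strict_mono_Suc_iff)
  have r1: "r k \<ge> 1" for k using r(1) by blast
  have limg: "(\<lambda>K. integral\<^sup>L (empirical_measure T x (r K)) (g k)) \<longlonglongrightarrow> integral\<^sup>L \<mu> (g k)" for k
  proof -
    have "(\<lambda>K. birkhoff_average T (g k) (r K) x - integral\<^sup>L \<mu> (g k)) \<longlonglongrightarrow> 0"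
    proof (rule Lim_null_comparison)
      show "(\<lambda>K. 3 / real (Suc K)) \<longlonglongrightarrow> 0"
        using LIMSEQ_Suc[OF lim_const_over_n[of "3::real"]] by simp
      show "\<forall>\<^sub>F K in sequentially. norm (birkhoff_average T (g k) (r K) x - integral\<^sup>L \<mu> (g k)) \<le> 3 / real (Suc K)"
        by (rule eventually_sequentiallyI[of "Suc k"])
           (use r(1) in \<open>auto simp: Suc_le_eq intro!: less_imp_le simp del: of_nat_Suc\<close>)
    qed
    then show ?thesis
      using r1 by (simp add: integral_empirical_measure[OF _ g] LIM_zero_iff)
  qed
  have "(\<lambda>K. integral\<^sup>L (empirical_measure T x (r K)) f) \<longlonglongrightarrow> integral\<^sup>L \<mu> f"
    if f: "continuous_on UNIV f" for f :: "'a \<Rightarrow> real"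
  proof (rule LIMSEQ_I)
    fix e :: real assume e: "e > 0"
    obtain p :: nat and \<sigma> c where approx: "\<And>x. \<bar>f x - (\<Sum>i<p. c i * g (\<sigma> i) x)\<bar> \<le> e / 3"
      using total[OF f, of "e / 3"] e by auto
    let ?h = "\<lambda>x. \<Sum>i<p. c i * g (\<sigma> i) x"
    have ch: "continuous_on UNIV ?h" using g by (intro continuous_intros)
    have inth: "integral\<^sup>L \<nu> ?h = (\<Sum>i<p. c i * integral\<^sup>L \<nu> (g (\<sigma> i)))" if "\<nu> \<in> borel_prob_measures" for \<nu>
      using integrable_continuous[OF X that g] by (simp add: Bochner_Integration.integral_sum)
    note emp = empirical_measure_borel_prob[OF r1, of T x]
    have "(\<lambda>K. integral\<^sup>L (empirical_measure T x (r K)) ?h) \<longlonglongrightarrow> integral\<^sup>L \<mu> ?h"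
      unfolding inth[OF \<mu>] inth[OF emp] by (intro tendsto_intros limg)
    then obtain K0 where K0: "\<And>K. K \<ge> K0 \<Longrightarrow>
        \<bar>integral\<^sup>L (empirical_measure T x (r K)) ?h - integral\<^sup>L \<mu> ?h\<bar> < e / 3"
      using LIMSEQ_D[of _ _ "e / 3"] e unfolding real_norm_def by fastforce
    show "\<exists>K0. \<forall>K\<ge>K0. norm (integral\<^sup>L (empirical_measure T x (r K)) f - integral\<^sup>L \<mu> f) < e"
    proof (intro exI allI impI)
      fix K assume "K \<ge> K0"
      then show "norm (integral\<^sup>L (empirical_measure T x (r K)) f - integral\<^sup>L \<mu> f) < e"
        using K0[of K] integral_diff_bound[OF X \<mu> f ch approx]
          integral_diff_bound[OF X emp[of K] f ch approx] unfolding real_norm_def by linarith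
    qed
  qed
  then have "limitin weak_star_topology (\<lambda>K. empirical_measure T x (r K)) \<mu> sequentially"
    using \<mu> empirical_measure_borel_prob[OF r1] by (subst limitin_weak_star_iff) auto
  then show ?thesis using mono r1 by (auto simp: limit_measures_def)
qed

lemma open_average_condition:
  fixes T :: "'a::metric_space \<Rightarrow> 'a" and K :: nat
  assumes "continuous_on UNIV T" "\<And>k. continuous_on UNIV (g k)"
  shows "open {x. \<exists>n\<ge>N. \<forall>k<K. \<bar>birkhoff_average T (g k) n x - v k\<bar> < e}"
proof -
  have "open {x. \<bar>birkhoff_average T (g k) n x - v k\<bar> < e}" for k n
    using continuous_birkhoff_average[OF assms(1) assms(2)]
    by (intro open_Collect_less continuous_intros) auto
  then have "open (\<Inter>k\<in>{..<K}. {x. \<bar>birkhoff_average T (g k) n x - v k\<bar> < e})" for n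
    by auto
  then have "open (\<Union>n\<in>{N..}. \<Inter>k\<in>{..<K}. {x. \<bar>birkhoff_average T (g k) n x - v k\<bar> < e})"
    by auto
  also have "(\<Union>n\<in>{N..}. \<Inter>k\<in>{..<K}. {x. \<bar>birkhoff_average T (g k) n x - v k\<bar> < e}) =
      {x. \<exists>n\<ge>N. \<forall>k<K. \<bar>birkhoff_average T (g k) n x - v k\<bar> < e}"
    by auto
  finally show ?thesis .
qed

theorem mainTheorem6:
  fixes T :: "'a::metric_space \<Rightarrow> 'a"
  assumes "compact (UNIV :: 'a set)"
    and "\<forall>x::'a. \<not> x isolated_in UNIV"
    and "continuous_on UNIV T"
    and "topologically_transitive T"
    and "shadowing_property T"
  shows "baire_generic {x. limit_measures T x = invariant_measures T}"
proof -
  note X = assms(1) and T = assms(3)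
  obtain g :: "nat \<Rightarrow> 'a \<Rightarrow> real"
    where g: "\<And>k. continuous_on UNIV (g k)" "\<And>k x. \<bar>g k x\<bar> \<le> 1"
    and total: "\<And>f \<epsilon>. continuous_on UNIV f \<Longrightarrow> \<epsilon> > 0 \<Longrightarrow>
      \<exists>p \<sigma> c. \<forall>x. \<bar>f x - (\<Sum>i<(p::nat). c i * g (\<sigma> i) x)\<bar> \<le> \<epsilon>"
  proof (rule countable_total_family[OF X], goal_cases)
    case (1 g)
    show ?case by (rule 1(1)[OF 1(2,3,4)])
  qed
  define G where "G = (\<lambda>(K, N, v :: int list). {x. \<exists>n\<ge>N. \<forall>k<K.
    \<bar>birkhoff_average T (g k) n x - real_of_int (v ! k) / real (Suc K)\<bar> < 2 / real (Suc K)})"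
  \<comment> \<open>Vectors \<open>v\<close> far from the integrals of every invariant measure may give sets that are not dense;
    those that round the integrals of an invariant measure will be seen to give dense sets.\<close>
  define \<G> where "\<G> = G ` {i. closure (G i) = UNIV}"
  have "countable \<G>" unfolding \<G>_def by (intro countable_image) auto
  moreover have "open U \<and> closure U = UNIV" if "U \<in> \<G>" for U
    using that open_average_condition[OF T g(1)] by (auto simp: \<G>_def G_def)
  moreover have "limit_measures T x = invariant_measures T" if x: "x \<in> \<Inter>\<G>" for x
  proof (intro equalityI limit_measures_invariant[OF X T] subsetI)
    fix \<mu> assume \<mu>: "\<mu> \<in> invariant_measures T"
    have "\<exists>n\<ge>N. \<forall>k<K. \<bar>birkhoff_average T (g k) n x - integral\<^sup>L \<mu> (g k)\<bar> < 3 / real (Suc K)" for K N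
    proof -
      define v where "v = map (\<lambda>k. \<lfloor>real (Suc K) * integral\<^sup>L \<mu> (g k)\<rfloor>) [0..<K]"
      have v: "\<bar>integral\<^sup>L \<mu> (g k) - real_of_int (v ! k) / real (Suc K)\<bar> < 1 / real (Suc K)" if "k < K" for k
      proof -
        have "integral\<^sup>L \<mu> (g k) - real_of_int (v ! k) / real (Suc K) =
            frac (real (Suc K) * integral\<^sup>L \<mu> (g k)) / real (Suc K)"
          using that by (simp add: v_def frac_def field_simps del: of_nat_Suc)
        then show ?thesis
          using frac_lt_1[of "real (Suc K) * integral\<^sup>L \<mu> (g k)"]
          by (simp add: abs_divide divide_strict_right_mono del: of_nat_Suc)
      qed
      have "U \<inter> G (K, N, v) \<noteq> {}" if U: "open U" "U \<noteq> {}" for U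
      proof -
        have "\<exists>z\<in>U. \<exists>n\<ge>N. \<forall>f\<in>g ` {..<K}.
            \<bar>birkhoff_average T f n z - integral\<^sup>L \<mu> f\<bar> < 1 / real (Suc K)"
          by (rule dense_prescribed_averages[OF X T assms(4,5) \<mu>]) (use g U in auto)
        then obtain z n where z: "z \<in> U" "n \<ge> N"
          "\<And>k. k < K \<Longrightarrow> \<bar>birkhoff_average T (g k) n z - integral\<^sup>L \<mu> (g k)\<bar> < 1 / real (Suc K)"
          by (metis imageI lessThan_iff)
        have "\<bar>birkhoff_average T (g k) n z - real_of_int (v ! k) / real (Suc K)\<bar> < 2 / real (Suc K)"
          if "k < K" for k
          using z(3)[OF that] v[OF that] by (simp del: of_nat_Suc)
        then have "z \<in> G (K, N, v)" using z(2) by (auto simp: G_def)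
        then show ?thesis using z(1) by auto
      qed
      then have "closure (G (K, N, v)) = UNIV"
        by (auto simp: closure_iff_nhds_not_empty) blast
      then have "x \<in> G (K, N, v)" using x by (auto simp: \<G>_def)
      then obtain n where n: "n \<ge> N" "\<And>k. k < K \<Longrightarrow>
          \<bar>birkhoff_average T (g k) n x - real_of_int (v ! k) / real (Suc K)\<bar> < 2 / real (Suc K)"
        by (auto simp: G_def)
      have "\<bar>birkhoff_average T (g k) n x - integral\<^sup>L \<mu> (g k)\<bar> < 3 / real (Suc K)" if "k < K" for k
        using n(2)[OF that] v[OF that] by (simp del: of_nat_Suc)
      then show ?thesis using n(1) by blast
    qed
    moreover have "\<mu> \<in> borel_prob_measures" using \<mu> by (simp add: invariant_measures_def)
    ultimately show "\<mu> \<in> limit_measures T x"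
      by (intro limit_measuresI[OF X T _ g(1) total]) auto
  qed
  ultimately show ?thesis unfolding baire_generic_def by (intro exI[of _ \<G>]) auto
qed

end
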